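(* Let $1\le p<\infty$, let $X$ be a complete, doubling metric measure space supporting a $(1,p)$-Poincaré inequality, and let $\Omega\subsetneq X$ be an open set. Assume that $\Omega$ admits the pointwise $p$-Hardy inequality with distance to the boundary: there exist constants $c_H>0$ and $L\ge1$ such that for all $u\in N_0^{1,p}(\Omega)$ $$|u(x)|\le c_H\,\delta_\Omega(x)\bigl(\mathcal{M}_{L\delta_\Omega(x)}g_u^p(x)\bigr)^{1/p}$$ holds at almost every $x\in\Omega$. Then there is a constant $C>0$ such that $$\mathscr{H}^{p}_{\delta_\Omega(x)}\bigl(\partial\Omega\cap\overline B(x,2L\delta_\Omega(x))\bigr)\ge C\,\delta_\Omega(x)^{-p}\mu\bigl(\overline B(x,\delta_\Omega(x))\bigr)$$ for all $x\in\Omega$.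
   Context: $X=(X,d,\mu)$ is a complete metric space with a Borel regular outer measure $\mu$ such that $0<\mu(B)<\infty$ for all balls $B=B(x,r)=\{y:d(x,y)<r\}$; $tB=B(x,tr)$, and $\overline B$ is the corresponding closed ball. $\mu$ is doubling: $\mu(2B)\le c_D\,\mu(B)$ for all balls $B$, with a constant $c_D\ge1$. For a ball $B$, $u_B=\frac1{\mu(B)}\int_B u\,d\mu$. A curve is a nonconstant, rectifiable, continuous mapping from a compact interval to $X$. The $p$-modulus of a curve family $\Gamma$ is $\inf\int_X\rho^p\,d\mu$ over Borel $\rho\ge0$ with $\int_\gamma\rho\,ds\ge1$ for all $\gamma\in\Gamma$. A measurable $g\ge0$ is a $p$-weak upper gradient of $u$ if, for all curves $\gamma$ (with endpoints $x,y$) outside a family of zero $p$-modulus, $|u(x)-u(y)|\le\int_\gamma g\,ds$ whenever $u(x),u(y)$ are both finite, and $\int_\gamma g\,ds=\infty$ otherwise. $g_u$ denotes a $p$-weak upper gradient of $u$; inequalities involving $g_u$ are meant for every $p$-weak upper gradient of $u$. $X$ supports a (weak) $(1,p)$-Poincaré inequality: there are $c_P>0$, $\tau\ge1$ such that for all balls $B$ of radius $r$, all locally integrable $u$ and all $p$-weak upper gradients $g_u$ of $u$, $\frac1{\mu(B)}\int_B|u-u_B|\,d\mu\le c_P\,r\bigl(\frac1{\mu(\tau B)}\int_{\tau B}g_u^p\,d\mu\bigr)^{1/p}$. $N^{1,p}(X)$ is the space of $u\in L^p(X)$ having a $p$-weak upper gradient in $L^p(X)$. $N_0^{1,p}(\Omega)=\{u|_\Omega:u\in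 N^{1,p}(X),\ u=0\text{ in }X\setminus\Omega\}$; functions in it are regarded as extended by zero to $X$. $\delta_\Omega(x)=d(x,\partial\Omega)$ for $x\in\Omega$. $\mathcal{M}_R f(x)=\sup_{0<r\le R}\frac1{\mu(B(x,r))}\int_{B(x,r)}|f|\,d\mu$. The Hausdorff content of codimension $t$ of $E\subset X$ is $\mathscr{H}^t_R(E)=\inf\bigl\{\sum_{i\in I}\mu(B(x_i,r_i))\,r_i^{-t}: E\subset\bigcup_{i\in I}B(x_i,r_i),\ r_i\le R\bigr\}$, over countable (possibly finite) covers by balls. *)

theory Defs
  imports "HOL-Analysis.Analysis"
begin

text \<open>
  The ambient metric space is the whole type. An outer measure \<open>mu\<close> is defined on all subsets;
  measurability and integration refer to its Caratheodory sigma-algebra.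
\<close>

definition borel_regular_outer_measure :: "('a::topological_space set \<Rightarrow> ennreal) \<Rightarrow> bool" where
  "borel_regular_outer_measure mu \<longleftrightarrow>
     outer_measure_space UNIV mu \<and>
     sets borel \<subseteq> lambda_system UNIV UNIV mu \<and>
     (\<forall>A. \<exists>B\<in>sets borel. A \<subseteq> B \<and> mu B = mu A)"

definition induced_measure :: "('a set \<Rightarrow> ennreal) \<Rightarrow> 'a measure" where
  "induced_measure mu = measure_of UNIV (lambda_system UNIV UNIV mu) mu"

lemma
  assumes "outer_measure_space UNIV mu"
  shows space_induced_measure: "space (induced_measure mu) = UNIV"
    and sets_induced_measure: "sets (induced_measure mu) = lambda_system UNIV UNIV mu"
    and emeasure_induced_measure:
      "A \<in> lambda_system UNIV UNIV mu \<Longrightarrow> emeasure (induced_measure mu) A = mu A"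
proof -
  have ms: "measure_space UNIV (lambda_system UNIV UNIV mu) mu"
    using sigma_algebra.caratheodory_lemma[OF sigma_algebra_Pow, of UNIV mu] assms by simp
  then interpret sigma_algebra UNIV "lambda_system UNIV UNIV mu"
    by (simp add: measure_space_def)
  show "space (induced_measure mu) = UNIV"
    by (simp add: induced_measure_def space_measure_of_conv)
  show sets: "sets (induced_measure mu) = lambda_system UNIV UNIV mu"
    by (simp add: induced_measure_def sets_measure_of_eq)
  show "emeasure (induced_measure mu) A = mu A" if "A \<in> lambda_system UNIV UNIV mu"
    using ms that sets
    by (intro emeasure_measure_of[OF induced_measure_def]) (auto simp: measure_space_def)
qed

definition doubling :: "('a::metric_space set \<Rightarrow> ennreal) \<Rightarrow> bool" where
  "doubling mu \<longleftrightarrow>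
     (\<exists>cD\<ge>1. \<forall>x. \<forall>r>0. mu (ball x (2 * r)) \<le> ennreal cD * mu (ball x r))"

text \<open>Powers \<open>x\<^sup>a\<close> of \<open>x \<in> [0,\<infinity>]\<close>; only meaningful for exponents \<open>a > 0\<close>.\<close>

definition enn_powr :: "ennreal \<Rightarrow> real \<Rightarrow> ennreal" where
  "enn_powr x a = (if x = \<infinity> then \<infinity> else ennreal (enn2real x powr a))"

definition average :: "('a set \<Rightarrow> ennreal) \<Rightarrow> 'a set \<Rightarrow> ('a \<Rightarrow> ennreal) \<Rightarrow> ennreal" where
  "average mu B f = (\<integral>\<^sup>+y\<in>B. f y \<partial>induced_measure mu) / mu B"

subsection \<open>Curves and line integrals\<close>

text \<open>A triple \<open>(a, b, \<gamma>)\<close> stands for \<open>\<gamma>\<close> restricted to the interval \<open>[a,b]\<close>.\<close>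

type_synonym 'a curve = "real \<times> real \<times> (real \<Rightarrow> 'a)"

definition path_length :: "real \<Rightarrow> real \<Rightarrow> (real \<Rightarrow> 'a::metric_space) \<Rightarrow> ennreal" where
  "path_length a b \<gamma> =
     (SUP (n, t) \<in> {(n :: nat, t :: nat \<Rightarrow> real). mono t \<and> range t \<subseteq> {a..b}}.
        \<Sum>i<n. ennreal (dist (\<gamma> (t i)) (\<gamma> (t (Suc i)))))"

definition curves :: "'a::metric_space curve set" where
  "curves = {(a, b, \<gamma>). a \<le> b \<and> continuous_on {a..b} \<gamma> \<and>
     \<not> \<gamma> constant_on {a..b} \<and> path_length a b \<gamma> < \<infinity>}"

text \<open>
  For a curve of length \<open>\<ell>\<close> and \<open>0 \<le> s \<le> \<ell>\<close>, this is the point reached after length \<open>s\<close>.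
  All \<open>t\<close> to which the choice applies give the same point \<open>\<gamma> t\<close>.
\<close>

definition arc_length_param :: "'a::metric_space curve \<Rightarrow> real \<Rightarrow> 'a" where
  "arc_length_param = (\<lambda>(a, b, \<gamma>) s.
     \<gamma> (SOME t. t \<in> {a..b} \<and> path_length a t \<gamma> = ennreal s))"

text \<open>
  Lebesgue rather than Borel measure, since \<open>\<rho>\<close> need only be measurable with respect to \<open>mu\<close>:
  for such \<open>\<rho>\<close>, composition with the parametrization is Lebesgue measurable for all curves
  outside a family of zero modulus.
\<close>

definition line_integral :: "'a::metric_space curve \<Rightarrow> ('a \<Rightarrow> ennreal) \<Rightarrow> ennreal" where
  "line_integral = (\<lambda>(a, b, \<gamma>) \<rho>.
     \<integral>\<^sup>+s\<in>{0..enn2real (path_length a b \<gamma>)}. \<rho> (arc_length_param (a, b, \<gamma>) s) \<partial>lebesgue)"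

definition p_modulus :: "('a::metric_space set \<Rightarrow> ennreal) \<Rightarrow> real \<Rightarrow> 'a curve set \<Rightarrow> ennreal" where
  "p_modulus mu p \<Gamma> =
     (INF \<rho> \<in> {\<rho> \<in> borel_measurable borel. \<forall>c\<in>\<Gamma>. 1 \<le> line_integral c \<rho>}.
        \<integral>\<^sup>+y. enn_powr (\<rho> y) p \<partial>induced_measure mu)"

subsection \<open>Sobolev functions\<close>

definition upper_gradient_along :: "('a::metric_space \<Rightarrow> ennreal) \<Rightarrow> ('a \<Rightarrow> ereal) \<Rightarrow> 'a curve \<Rightarrow> bool" where
  "upper_gradient_along g u = (\<lambda>(a, b, \<gamma>).
     if \<bar>u (\<gamma> a)\<bar> \<noteq> \<infinity> \<and> \<bar>u (\<gamma> b)\<bar> \<noteq> \<infinity>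
     then e2ennreal \<bar>u (\<gamma> a) - u (\<gamma> b)\<bar> \<le> line_integral (a, b, \<gamma>) g
     else line_integral (a, b, \<gamma>) g = \<infinity>)"

definition weak_upper_gradient ::
  "('a::metric_space set \<Rightarrow> ennreal) \<Rightarrow> real \<Rightarrow> ('a \<Rightarrow> ennreal) \<Rightarrow> ('a \<Rightarrow> ereal) \<Rightarrow> bool" where
  "weak_upper_gradient mu p g u \<longleftrightarrow>
     g \<in> borel_measurable (induced_measure mu) \<and>
     (\<exists>\<Gamma>\<subseteq>curves. p_modulus mu p \<Gamma> = 0 \<and> (\<forall>c\<in>curves - \<Gamma>. upper_gradient_along g u c))"

definition locally_integrable :: "('a::metric_space set \<Rightarrow> ennreal) \<Rightarrow> ('a \<Rightarrow> ereal) \<Rightarrow> bool" where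
  "locally_integrable mu u \<longleftrightarrow>
     u \<in> borel_measurable (induced_measure mu) \<and>
     (\<forall>x. \<exists>r>0. (\<integral>\<^sup>+y\<in>ball x r. e2ennreal \<bar>u y\<bar> \<partial>induced_measure mu) < \<infinity>)"

text \<open>
  The mean value of \<open>u\<close>, meant for \<open>u\<close> integrable on \<open>B\<close>; such \<open>u\<close> is finite almost everywhere
  on \<open>B\<close>, so passing to real values is harmless.
\<close>

definition mean_value :: "('a set \<Rightarrow> ennreal) \<Rightarrow> 'a set \<Rightarrow> ('a \<Rightarrow> ereal) \<Rightarrow> real" where
  "mean_value mu B u = (LINT y:B|induced_measure mu. real_of_ereal (u y)) / enn2real (mu B)"

definition poincare_inequality :: "('a::metric_space set \<Rightarrow> ennreal) \<Rightarrow> real \<Rightarrow> bool" where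
  "poincare_inequality mu p \<longleftrightarrow>
     (\<exists>cP>0. \<exists>\<tau>\<ge>1. \<forall>x. \<forall>r>0. \<forall>u g.
        locally_integrable mu u \<longrightarrow> weak_upper_gradient mu p g u \<longrightarrow>
        average mu (ball x r) (\<lambda>y. e2ennreal \<bar>u y - ereal (mean_value mu (ball x r) u)\<bar>)
          \<le> ennreal (cP * r) *
            enn_powr (average mu (ball x (\<tau> * r)) (\<lambda>y. enn_powr (g y) p)) (1 / p))"

definition sobolev :: "('a::metric_space set \<Rightarrow> ennreal) \<Rightarrow> real \<Rightarrow> ('a \<Rightarrow> ereal) set" where
  "sobolev mu p = {u. u \<in> borel_measurable (induced_measure mu) \<and>
     (\<integral>\<^sup>+y. enn_powr (e2ennreal \<bar>u y\<bar>) p \<partial>induced_measure mu) < \<infinity> \<and>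
     (\<exists>g. weak_upper_gradient mu p g u \<and>
          (\<integral>\<^sup>+y. enn_powr (g y) p \<partial>induced_measure mu) < \<infinity>)}"

text \<open>Elements are represented by their extension by zero, as functions on the whole space.\<close>

definition sobolev0 ::
  "('a::metric_space set \<Rightarrow> ennreal) \<Rightarrow> real \<Rightarrow> 'a set \<Rightarrow> ('a \<Rightarrow> ereal) set" where
  "sobolev0 mu p \<Omega> = {u \<in> sobolev mu p. \<forall>x\<in>- \<Omega>. u x = 0}"

subsection \<open>Hardy inequality and Hausdorff content\<close>

definition maximal_function ::
  "('a::metric_space set \<Rightarrow> ennreal) \<Rightarrow> real \<Rightarrow> ('a \<Rightarrow> ennreal) \<Rightarrow> 'a \<Rightarrow> ennreal" where
  "maximal_function mu R f x = (SUP r\<in>{0<..R}. average mu (ball x r) f)"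

text \<open>
  The convention \<open>infdist x {} = 0\<close> plays no role: a Poincare inequality forces the space to be
  connected, so a nonempty proper open subset has nonempty boundary.
\<close>

definition boundary_dist :: "'a::metric_space set \<Rightarrow> 'a \<Rightarrow> real" where
  "boundary_dist \<Omega> x = infdist x (frontier \<Omega>)"

definition pointwise_hardy ::
  "('a::metric_space set \<Rightarrow> ennreal) \<Rightarrow> real \<Rightarrow> 'a set \<Rightarrow> real \<Rightarrow> real \<Rightarrow> bool" where
  "pointwise_hardy mu p \<Omega> cH L \<longleftrightarrow>
     (\<forall>u\<in>sobolev0 mu p \<Omega>. \<forall>g. weak_upper_gradient mu p g u \<longrightarrow>
        (AE x in induced_measure mu. x \<in> \<Omega> \<longrightarrow>
           e2ennreal \<bar>u x\<bar> \<le> ennreal (cH * boundary_dist \<Omega> x) *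
             enn_powr (maximal_function mu (L * boundary_dist \<Omega> x) (\<lambda>y. enn_powr (g y) p) x)
               (1 / p)))"

definition hausdorff_content ::
  "('a::metric_space set \<Rightarrow> ennreal) \<Rightarrow> real \<Rightarrow> real \<Rightarrow> 'a set \<Rightarrow> ennreal" where
  "hausdorff_content mu t R E =
     (INF (I, x, r) \<in> {(I :: nat set, x :: nat \<Rightarrow> 'a, r :: nat \<Rightarrow> real).
          E \<subseteq> (\<Union>i\<in>I. ball (x i) (r i)) \<and> (\<forall>i\<in>I. 0 < r i \<and> r i \<le> R)}.
        \<Sum>\<^sub>\<infinity>i\<in>I. mu (ball (x i) (r i)) * ennreal (r i powr (- t)))"

end

theory Submission
  imports Defs
begin

text \<open>
  Let \<open>\<delta> = \<delta>\<^sub>\<Omega>(x)\<close> and let balls \<open>B\<^sub>i = B(x\<^sub>i, r\<^sub>i)\<close> cover the relevant part of the boundary. If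
  some \<open>r\<^sub>i \<ge> \<delta>/8\<close>, doubling already bounds the \<open>i\<close>-th term from below. Otherwise test the Hardy
  inequality with \<open>u = min(\<psi>, inf\<^sub>i \<phi>\<^sub>i)\<close> on \<open>\<Omega>\<close>, where \<open>\<phi>\<^sub>i\<close> vanishes on \<open>B\<^sub>i\<close> and is \<open>1\<close> off
  \<open>2B\<^sub>i\<close>, and \<open>\<psi>\<close> is \<open>1\<close> on \<open>B(x, 3L\<delta>/2)\<close> and \<open>0\<close> off \<open>B(x, 2L\<delta>)\<close>. Then \<open>u\<close> vanishes on \<open>\<partial>\<Omega>\<close>,
  so it can be extended by zero, and the supremum of the slopes \<open>1/r\<^sub>i\<close> on \<open>2B\<^sub>i\<close> and \<open>2/(L\<delta>)\<close> on
  \<open>{0 < \<psi> < 1}\<close> is an upper gradient. At a point \<open>y\<close> near \<open>x\<close> we have \<open>u(y) = 1\<close>; the balls seen by the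
  maximal function avoid \<open>{0 < \<psi> < 1}\<close>, and those of radius at most \<open>\<delta>/4\<close> avoid all \<open>2B\<^sub>i\<close>. Hence
  the maximal function at this one point is at most a constant times
  \<open>\<mu>(B(x,\<delta>))\<^sup>-\<^sup>1 \<Sum>\<^sub>i \<mu>(B\<^sub>i) r\<^sub>i\<^sup>-\<^sup>p\<close>.
\<close>

section \<open>Arc length\<close>

lemma path_length_mono:
  assumes "c \<le> a" "b \<le> d"
  shows "path_length a b \<gamma> \<le> path_length c d \<gamma>"
  unfolding path_length_def
  by (rule SUP_subset_mono) (use assms in fastforce)+

lemma path_length_upper:
  assumes "mono t" "range t \<subseteq> {a..b}"
  shows "(\<Sum>i<n. ennreal (dist (\<gamma> (t i)) (\<gamma> (t (Suc i))))) \<le> path_length a b \<gamma>"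
  unfolding path_length_def
  using assms SUP_upper[of "(n, t)" "{(n, t). mono t \<and> range t \<subseteq> {a..b}}"
    "\<lambda>(n, t). \<Sum>i<n. ennreal (dist (\<gamma> (t i)) (\<gamma> (t (Suc i))))"] by simp

lemma path_length_least:
  assumes "\<And>n t. mono t \<Longrightarrow> range t \<subseteq> {a..b} \<Longrightarrow>
    (\<Sum>i<n. ennreal (dist (\<gamma> (t i)) (\<gamma> (t (Suc i))))) \<le> M"
  shows "path_length a b \<gamma> \<le> M"
  unfolding path_length_def using assms by (auto intro!: SUP_least)

lemma dist_le_path_length:
  assumes "a \<le> b"
  shows "ennreal (dist (\<gamma> a) (\<gamma> b)) \<le> path_length a b \<gamma>"
proof -
  have "mono (\<lambda>i::nat. if i = 0 then a else b)" "range (\<lambda>i::nat. if i = 0 then a else b) \<subseteq> {a..b}"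
    using assms by (auto simp: mono_def)
  from path_length_upper[OF this, where n = 1] show ?thesis by simp
qed

text \<open>Since \<open>a \<le> b\<close> provides at least the constant partition, the supremum
  runs over a nonempty set and \<open>z\<close> may be moved inside it. Superadditivity uses this
  twice, once for each of its two suprema.\<close>

lemma path_length_add_least:
  assumes "a \<le> b" and "\<And>n t. mono t \<Longrightarrow> range t \<subseteq> {a..b} \<Longrightarrow>
    (\<Sum>i<n. ennreal (dist (\<gamma> (t i)) (\<gamma> (t (Suc i))))) + z \<le> M"
  shows "path_length a b \<gamma> + z \<le> M"
proof -
  have ne: "{(n :: nat, t :: nat \<Rightarrow> real). mono t \<and> range t \<subseteq> {a..b}} \<noteq> {}"
    using assms(1) by (auto intro!: exI[of _ "\<lambda>_. a"] simp: mono_def)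
  show ?thesis
    unfolding path_length_def ennreal_SUP_add_left[OF ne, symmetric]
    using assms(2) by (auto simp del: sum_ennreal intro!: SUP_least)
qed

lemma path_length_superadditive:
  assumes "a \<le> c" "c \<le> b"
  shows "path_length a c \<gamma> + path_length c b \<gamma> \<le> path_length a b \<gamma>"
proof -
  have *: "(\<Sum>i<n. ennreal (dist (\<gamma> (t i)) (\<gamma> (t (Suc i))))) +
      (\<Sum>i<m. ennreal (dist (\<gamma> (s i)) (\<gamma> (s (Suc i))))) \<le> path_length a b \<gamma>"
    if t: "mono t" "range t \<subseteq> {a..c}" and s: "mono s" "range s \<subseteq> {c..b}" for n m and t s :: "nat \<Rightarrow> real"
  proof -
    \<comment> \<open>Concatenation: indices up to \<open>n\<close> follow \<open>t\<close>, later
      ones follow \<open>s\<close>. The step from \<open>t n\<close> to \<open>s 0\<close> at index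
      \<open>n\<close> adds one nonnegative term, hence \<open>Suc n + m\<close> summands.\<close>
    define q where "q i = (if i \<le> n then t i else s (i - Suc n))" for i
    have "mono q"
    proof (rule monoI)
      fix i j :: nat assume "i \<le> j"
      then have "t i \<le> t j" "s (i - Suc n) \<le> s (j - Suc n)"
        using t(1) s(1) by (simp_all add: monoD)
      moreover have "t i \<le> s (j - Suc n)"
        using t(2) s(2) by (meson atLeastAtMost_iff order_trans rangeI subsetD)
      ultimately show "q i \<le> q j"
        using \<open>i \<le> j\<close> by (auto simp: q_def)
    qed
    moreover have "range q \<subseteq> {a..b}"
    proof
      fix z assume "z \<in> range q"
      then obtain i where "z = q i" by auto
      moreover have "t i \<in> {a..c}" "s (i - Suc n) \<in> {c..b}"
        using subsetD[OF t(2) rangeI] subsetD[OF s(2) rangeI] by blast+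
      ultimately show "z \<in> {a..b}"
        using assms by (auto simp: q_def)
    qed
    ultimately have "(\<Sum>i<Suc n + m. ennreal (dist (\<gamma> (q i)) (\<gamma> (q (Suc i))))) \<le> path_length a b \<gamma>"
      by (rule path_length_upper)
    moreover have split: "(\<Sum>i<Suc n + m. f i) = (\<Sum>i<Suc n. f i) + (\<Sum>i<m. f (Suc n + i))"
      for f :: "nat \<Rightarrow> ennreal"
      by (induction m) (auto simp: ac_simps)
    ultimately have "(\<Sum>i<Suc n. ennreal (dist (\<gamma> (q i)) (\<gamma> (q (Suc i))))) +
        (\<Sum>i<m. ennreal (dist (\<gamma> (q (Suc n + i))) (\<gamma> (q (Suc (Suc n + i)))))) \<le> path_length a b \<gamma>"
      by (simp only: split)
    moreover have "(\<Sum>i<n. ennreal (dist (\<gamma> (t i)) (\<gamma> (t (Suc i)))))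
        \<le> (\<Sum>i<Suc n. ennreal (dist (\<gamma> (q i)) (\<gamma> (q (Suc i)))))"
      by (simp add: q_def)
    moreover have "(\<Sum>i<m. ennreal (dist (\<gamma> (s i)) (\<gamma> (s (Suc i)))))
        = (\<Sum>i<m. ennreal (dist (\<gamma> (q (Suc n + i))) (\<gamma> (q (Suc (Suc n + i))))))"
      by (simp add: q_def)
    ultimately show ?thesis
      by (metis (no_types, lifting) add_right_mono order_trans)
  qed
  show ?thesis
  proof (rule path_length_add_least[OF assms(1)])
    fix n and t :: "nat \<Rightarrow> real" assume t: "mono t" "range t \<subseteq> {a..c}"
    have "path_length c b \<gamma> + (\<Sum>i<n. ennreal (dist (\<gamma> (t i)) (\<gamma> (t (Suc i))))) \<le> path_length a b \<gamma>"
      by (rule path_length_add_least[OF assms(2)]) (subst add.commute, rule *[OF t])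
    then show "(\<Sum>i<n. ennreal (dist (\<gamma> (t i)) (\<gamma> (t (Suc i))))) + path_length c b \<gamma> \<le> path_length a b \<gamma>"
      by (subst add.commute)
  qed
qed

lemma path_length_subadditive:
  assumes "a \<le> c" "c \<le> b"
  shows "path_length a b \<gamma> \<le> path_length a c \<gamma> + path_length c b \<gamma>"
proof (rule path_length_least)
  fix n and t :: "nat \<Rightarrow> real" assume t: "mono t" "range t \<subseteq> {a..b}"
  \<comment> \<open>Clamping at \<open>c\<close> gives partitions of the two halves. A step across
    \<open>c\<close> is estimated by the triangle inequality through \<open>\<gamma> c\<close>; any
    other step survives in one half and is constant in the other.\<close>
  let ?l = "\<lambda>i. min (t i) c" and ?r = "\<lambda>i. max (t i) c"
  have tr: "dist (\<gamma> (t i)) (\<gamma> (t (Suc i)))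
      \<le> dist (\<gamma> (?l i)) (\<gamma> (?l (Suc i))) + dist (\<gamma> (?r i)) (\<gamma> (?r (Suc i)))" for i
    using monoD[OF t(1), of i "Suc i"] dist_triangle[of "\<gamma> (t i)" "\<gamma> (t (Suc i))" "\<gamma> c"]
    by (auto simp: min_def max_def)
  have "(\<Sum>i<n. ennreal (dist (\<gamma> (t i)) (\<gamma> (t (Suc i)))))
      \<le> (\<Sum>i<n. ennreal (dist (\<gamma> (?l i)) (\<gamma> (?l (Suc i))))) +
        (\<Sum>i<n. ennreal (dist (\<gamma> (?r i)) (\<gamma> (?r (Suc i)))))"
    unfolding sum.distrib[symmetric] using tr
    by (intro sum_mono) (simp add: ennreal_plus[symmetric] ennreal_leI del: ennreal_plus)
  also have "\<dots> \<le> path_length a c \<gamma> + path_length c b \<gamma>"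
  proof (intro add_mono path_length_upper)
    show "mono ?l" "mono ?r" using t(1) by (fastforce simp: mono_def)+
    show "range ?l \<subseteq> {a..c}" "range ?r \<subseteq> {c..b}"
      using t(2) assms by (auto simp: image_subset_iff min_def max_def)
  qed
  finally show "(\<Sum>i<n. ennreal (dist (\<gamma> (t i)) (\<gamma> (t (Suc i))))) \<le> \<dots>" .
qed

lemma path_length_add:
  assumes "a \<le> c" "c \<le> b"
  shows "path_length a b \<gamma> = path_length a c \<gamma> + path_length c b \<gamma>"
  using path_length_subadditive[OF assms] path_length_superadditive[OF assms] by (rule antisym)

text \<open>
  Both partial lengths are suprema of continuous functions of the cut point, hence lower
  semicontinuous. As their sum is constant, they are continuous when the total length is finite.
\<close>

lemma eventually_less_path_length:
  assumes \<gamma>: "continuous_on {a..b} \<gamma>" and s: "s \<in> {a..b}"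
  shows "y < path_length a s \<gamma> \<Longrightarrow> \<forall>\<^sub>F u in at s within {a..b}. y < path_length a u \<gamma>"
    and "y < path_length s b \<gamma> \<Longrightarrow> \<forall>\<^sub>F u in at s within {a..b}. y < path_length u b \<gamma>"
proof -
  \<comment> \<open>Common to both claims, with \<open>min\<close> or \<open>max\<close> as
    \<open>c\<close>: a partition whose sum exceeds \<open>y\<close> at \<open>s\<close> is clamped
    at a moving point \<open>u\<close>, which keeps it admissible there, and the clamped sum depends
    continuously on \<open>u\<close>.\<close>
  have ev: "\<forall>\<^sub>F u in at s within {a..b}. y < V u"
    if t: "mono t" "range t \<subseteq> {a..b}" and c: "\<And>z. continuous_on {a..b} (c z)"
      and r: "\<And>z u. z \<in> {a..b} \<Longrightarrow> u \<in> {a..b} \<Longrightarrow> c z u \<in> {a..b}"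
      and y: "y < (\<Sum>i<n. ennreal (dist (\<gamma> (c (t i) s)) (\<gamma> (c (t (Suc i)) s))))"
      and V: "\<And>u. u \<in> {a..b} \<Longrightarrow>
        (\<Sum>i<n. ennreal (dist (\<gamma> (c (t i) u)) (\<gamma> (c (t (Suc i)) u)))) \<le> V u"
    for n and t :: "nat \<Rightarrow> real" and c :: "real \<Rightarrow> real \<Rightarrow> real" and V :: "real \<Rightarrow> ennreal"
  proof -
    have "continuous_on {a..b} (\<lambda>u. \<gamma> (c (t i) u))" for i
      using t(2) r by (intro continuous_on_compose2[OF \<gamma> c]) (auto simp: image_subset_iff)
    then have "continuous_on {a..b} (\<lambda>u. \<Sum>i<n. dist (\<gamma> (c (t i) u)) (\<gamma> (c (t (Suc i)) u)))"
      by (intro continuous_intros)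
    then have "((\<lambda>u. ennreal (\<Sum>i<n. dist (\<gamma> (c (t i) u)) (\<gamma> (c (t (Suc i)) u)))) \<longlongrightarrow>
        ennreal (\<Sum>i<n. dist (\<gamma> (c (t i) s)) (\<gamma> (c (t (Suc i)) s)))) (at s within {a..b})"
      using s by (intro tendsto_ennrealI) (auto simp: continuous_on_def)
    from order_tendstoD(1)[OF this, of y] y
    have "\<forall>\<^sub>F u in at s within {a..b}.
        y < (\<Sum>i<n. ennreal (dist (\<gamma> (c (t i) u)) (\<gamma> (c (t (Suc i)) u))))"
      by (simp add: sum_ennreal)
    moreover have "\<forall>\<^sub>F u in at s within {a..b}. u \<in> {a..b}"
      by (simp add: eventually_at_filter)
    ultimately show ?thesis
      by eventually_elim (use V less_le_trans in blast)
  qed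
  show "\<forall>\<^sub>F u in at s within {a..b}. y < path_length a u \<gamma>" if "y < path_length a s \<gamma>"
  proof -
    from that obtain n t where t: "mono t" "range t \<subseteq> {a..s}"
      and y: "y < (\<Sum>i<n. ennreal (dist (\<gamma> (t i)) (\<gamma> (t (Suc i)))))"
      unfolding path_length_def less_SUP_iff by auto
    have [simp]: "min (t i) s = t i" for i
      using t(2) by (auto simp: image_subset_iff min_def)
    show ?thesis
    proof (rule ev[of t min n])
      show "range t \<subseteq> {a..b}" using t(2) s by fastforce
      fix u assume u: "u \<in> {a..b}"
      show "(\<Sum>i<n. ennreal (dist (\<gamma> (min (t i) u)) (\<gamma> (min (t (Suc i)) u)))) \<le> path_length a u \<gamma>"
        using t u by (intro path_length_upper) (fastforce simp: mono_def image_subset_iff)+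
    qed (use t y s in \<open>auto intro!: continuous_intros\<close>)
  qed
  show "\<forall>\<^sub>F u in at s within {a..b}. y < path_length u b \<gamma>" if "y < path_length s b \<gamma>"
  proof -
    from that obtain n t where t: "mono t" "range t \<subseteq> {s..b}"
      and y: "y < (\<Sum>i<n. ennreal (dist (\<gamma> (t i)) (\<gamma> (t (Suc i)))))"
      unfolding path_length_def less_SUP_iff by auto
    have [simp]: "max (t i) s = t i" for i
      using subsetD[OF t(2) rangeI, of i] by simp
    show ?thesis
    proof (rule ev[of t max n])
      show "range t \<subseteq> {a..b}" using t(2) s by fastforce
      fix u assume u: "u \<in> {a..b}"
      show "(\<Sum>i<n. ennreal (dist (\<gamma> (max (t i) u)) (\<gamma> (max (t (Suc i)) u)))) \<le> path_length u b \<gamma>"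
        using t u by (intro path_length_upper) (fastforce simp: mono_def image_subset_iff)+
    qed (use t y s in \<open>auto intro!: continuous_intros\<close>)
  qed
qed

lemma continuous_on_path_length:
  assumes "continuous_on {a..b} \<gamma>" and fin: "path_length a b \<gamma> < \<infinity>"
  shows "continuous_on {a..b} (\<lambda>s. enn2real (path_length a s \<gamma>))"
  unfolding continuous_on_def
proof
  fix s assume s: "s \<in> {a..b}"
  let ?F = "at s within {a..b}"
  have add: "path_length a b \<gamma> = path_length a u \<gamma> + path_length u b \<gamma>" if "u \<in> {a..b}" for u
    using that by (intro path_length_add) auto
  have fin': "path_length a u \<gamma> < \<infinity>" "path_length u b \<gamma> < \<infinity>" if "u \<in> {a..b}" for u
    using add[OF that] fin by simp_all
  define f where "f u = enn2real (path_length a u \<gamma>)" for u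
  define h where "h u = enn2real (path_length u b \<gamma>)" for u
  have f: "ennreal (f u) = path_length a u \<gamma>" and h: "ennreal (h u) = path_length u b \<gamma>"
    if "u \<in> {a..b}" for u using fin'[OF that] by (simp_all add: f_def h_def)
  have nonneg: "0 \<le> f u" "0 \<le> h u" for u by (simp_all add: f_def h_def)
  have const: "f u + h u = f s + h s" if "u \<in> {a..b}" for u
  proof -
    have "ennreal (f u + h u) = ennreal (f s + h s)"
      using add[OF that] add[OF s] f[OF that] h[OF that] f[OF s] h[OF s]
      by (simp add: nonneg ennreal_plus)
    then show ?thesis by (simp add: nonneg del: ennreal_plus)
  qed
  have ev: "\<forall>\<^sub>F u in ?F. u \<in> {a..b}"
    by (simp add: eventually_at_filter)
  have lower: "\<forall>\<^sub>F u in ?F. y < k u"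
    if "\<And>u. u \<in> {a..b} \<Longrightarrow> ennreal (k u) = V u" and "y < k s" and "\<And>u. 0 \<le> k u"
      and "\<And>y. y < V s \<Longrightarrow> \<forall>\<^sub>F u in ?F. y < V u" for y k V
  proof (cases "y < 0")
    case True
    then show ?thesis using that(3) by (auto intro!: always_eventually intro: less_le_trans)
  next
    case False
    then have "ennreal y < V s"
      using that(1)[OF s] that(2) by (metis ennreal_less_iff leI)
    with ev that(4)[of "ennreal y"] show ?thesis
    proof (elim eventually_elim2 [rotated])
      fix u assume u: "u \<in> {a..b}" and "ennreal y < V u"
      then have "ennreal y < ennreal (k u)" using that(1) by simp
      then show "y < k u" using False by (simp add: ennreal_less_iff)
    qed
  qed
  show "((\<lambda>u. enn2real (path_length a u \<gamma>)) \<longlongrightarrow> enn2real (path_length a s \<gamma>)) ?F"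
    unfolding f_def[symmetric]
  proof (rule order_tendstoI)
    fix y assume "y < f s"
    then show "\<forall>\<^sub>F u in ?F. y < f u"
      by (intro lower[OF f]) (auto simp: f_def intro: eventually_less_path_length[OF assms(1) s])
  next
    fix y assume "f s < y"
    \<comment> \<open>As \<open>f + h\<close> is constant on the interval, a lower bound for
      \<open>h\<close> near \<open>s\<close> is an upper bound for \<open>f\<close>.\<close>
    then have "f s + h s - y < h s" by simp
    then have "\<forall>\<^sub>F u in ?F. f s + h s - y < h u"
      by (intro lower[OF h]) (auto simp: h_def intro: eventually_less_path_length[OF assms(1) s])
    with ev show "\<forall>\<^sub>F u in ?F. f u < y"
    proof eventually_elim
      case (elim u)
      then show ?case using const[of u] by linarith
    qed
  qed
qed

text \<open>The length from \<open>a\<close> grows continuously from zero to the total length, so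
  the intermediate value theorem shows that the choice in \<open>arc_length_param\<close> has a
  candidate.\<close>

lemma arc_length_param_eq:
  assumes "continuous_on {a..b} \<gamma>" "path_length a b \<gamma> < \<infinity>" "a \<le> b"
    and "0 \<le> s" "s \<le> enn2real (path_length a b \<gamma>)"
  obtains t where "t \<in> {a..b}" "path_length a t \<gamma> = ennreal s" "arc_length_param (a, b, \<gamma>) s = \<gamma> t"
proof -
  have "path_length a a \<gamma> = 0"
    unfolding path_length_def by (intro SUP_eq_const) (auto simp: image_subset_iff mono_def)
  then have "\<exists>t\<ge>a. t \<le> b \<and> enn2real (path_length a t \<gamma>) = s"
    using assms by (intro IVT' continuous_on_path_length) auto
  then obtain t where t: "t \<in> {a..b}" "enn2real (path_length a t \<gamma>) = s" by auto
  have "path_length a t \<gamma> < \<infinity>"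
    using path_length_mono[of a a t b \<gamma>] t assms(2) by (auto intro: le_less_trans)
  then have "path_length a t \<gamma> = ennreal s"
    using t(2) by auto
  then have "\<exists>t. t \<in> {a..b} \<and> path_length a t \<gamma> = ennreal s"
    using t(1) by blast
  from someI_ex[OF this] show ?thesis
    by (intro that[of "SOME t. t \<in> {a..b} \<and> path_length a t \<gamma> = ennreal s"])
      (auto simp: arc_length_param_def)
qed

text \<open>By additivity, the length between the two parameters is the difference of the lengths
  from \<open>a\<close>, and it dominates the distance of the points. For \<open>s = s'\<close> this
  makes the point independent of the chosen parameter.\<close>

lemma dist_le_path_length_diff:
  assumes "t \<in> {a..b}" "t' \<in> {a..b}" "path_length a t \<gamma> = ennreal s" "path_length a t' \<gamma> = ennreal s'"
    and "0 \<le> s" "0 \<le> s'"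
  shows "dist (\<gamma> t) (\<gamma> t') \<le> \<bar>s - s'\<bar>"
proof -
  have *: "dist (\<gamma> t) (\<gamma> t') \<le> s' - s"
    if "a \<le> t" "t \<le> t'" "path_length a t \<gamma> = ennreal s" "path_length a t' \<gamma> = ennreal s'"
      "0 \<le> s" "0 \<le> s'"
    for t t' s s'
  proof -
    have "ennreal (s + dist (\<gamma> t) (\<gamma> t')) \<le> path_length a t \<gamma> + path_length t t' \<gamma>"
      using dist_le_path_length[of t t' \<gamma>] that by (simp add: ennreal_plus add_left_mono)
    also have "\<dots> = ennreal s'"
      using that by (metis path_length_add)
    finally show ?thesis using that by (simp add: ennreal_le_iff flip: ennreal_plus)
  qed
  show ?thesis
    using *[of t t' s s'] *[of t' t s' s] assms by (cases "t \<le> t'") (auto simp: dist_commute)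
qed

lemma arc_length_param_lipschitz:
  assumes "continuous_on {a..b} \<gamma>" "path_length a b \<gamma> < \<infinity>" "a \<le> b"
  shows "1-lipschitz_on {0..enn2real (path_length a b \<gamma>)} (arc_length_param (a, b, \<gamma>))"
proof (rule lipschitz_onI)
  fix s s' assume s: "s \<in> {0..enn2real (path_length a b \<gamma>)}" "s' \<in> {0..enn2real (path_length a b \<gamma>)}"
  obtain t where "t \<in> {a..b}" "path_length a t \<gamma> = ennreal s" "arc_length_param (a, b, \<gamma>) s = \<gamma> t"
    using arc_length_param_eq[OF assms] s by (metis atLeastAtMost_iff)
  moreover obtain t' where "t' \<in> {a..b}" "path_length a t' \<gamma> = ennreal s'"
      "arc_length_param (a, b, \<gamma>) s' = \<gamma> t'"
    using arc_length_param_eq[OF assms] s by (metis atLeastAtMost_iff)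
  ultimately show "dist (arc_length_param (a, b, \<gamma>) s) (arc_length_param (a, b, \<gamma>) s') \<le> 1 * dist s s'"
    using s dist_le_path_length_diff[of t a b t' \<gamma> s s'] by (simp add: dist_real_def)
qed simp

lemma arc_length_param_endpoints:
  assumes "continuous_on {a..b} \<gamma>" "path_length a b \<gamma> < \<infinity>" "a \<le> b"
  shows "arc_length_param (a, b, \<gamma>) 0 = \<gamma> a"
    and "arc_length_param (a, b, \<gamma>) (enn2real (path_length a b \<gamma>)) = \<gamma> b"
proof -
  have a: "path_length a a \<gamma> = ennreal 0"
    unfolding path_length_def by (auto intro!: SUP_eq_const simp: image_subset_iff mono_def)
  obtain t where t: "t \<in> {a..b}" "path_length a t \<gamma> = ennreal 0" "arc_length_param (a, b, \<gamma>) 0 = \<gamma> t"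
    using arc_length_param_eq[OF assms, of 0] by auto
  show "arc_length_param (a, b, \<gamma>) 0 = \<gamma> a"
    using dist_le_path_length_diff[OF t(1) _ t(2) a] t(3) assms(3) by simp
  let ?l = "enn2real (path_length a b \<gamma>)"
  obtain t where t: "t \<in> {a..b}" "path_length a t \<gamma> = ennreal ?l" "arc_length_param (a, b, \<gamma>) ?l = \<gamma> t"
    using arc_length_param_eq[OF assms, of ?l] by auto
  have "path_length a b \<gamma> = ennreal ?l" using assms(2) by simp
  then show "arc_length_param (a, b, \<gamma>) ?l = \<gamma> b"
    using dist_le_path_length_diff[OF t(1) _ t(2), of b ?l] t(3) assms(3) by simp
qed

section \<open>Upper gradients of infima of Lipschitz functions\<close>

text \<open>The whole change is made on a stretch where the values lie strictly between those at the
  ends. If \<open>v c \<le> v d\<close>, take for \<open>d'\<close> the first time the upper level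
  is reached and for \<open>c'\<close> the last time before it at or below the lower level; the
  other case follows by passing to \<open>- v\<close>.\<close>

lemma lipschitz_on_middle_interval:
  fixes v :: "real \<Rightarrow> real"
  assumes "K-lipschitz_on {c..d} v" "c \<le> d"
  obtains c' d' where "c \<le> c'" "c' \<le> d'" "d' \<le> d" "\<bar>v c - v d\<bar> \<le> K * (d' - c')"
    "\<And>s. s \<in> {c'<..<d'} \<Longrightarrow> min (v c) (v d) < v s \<and> v s < max (v c) (v d)"
proof -
  have *: "\<exists>c' d'. c \<le> c' \<and> c' \<le> d' \<and> d' \<le> d \<and> v d - v c \<le> K * (d' - c') \<and>
      (\<forall>s\<in>{c'<..<d'}. v c < v s \<and> v s < v d)"
    if v: "K-lipschitz_on {c..d} v" and le: "v c \<le> v d" for v :: "real \<Rightarrow> real"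
  proof -
    have cont: "continuous_on {c..d} v"
      using v by (rule lipschitz_on_continuous_on)
    have "closed ({c..d} \<inter> v -` {v d..})"
      using cont by (intro continuous_closed_preimage) auto
    then have "compact ({c..d} \<inter> v -` {v d..})"
      by (metis compact_Icc compact_Int_closed inf.idem inf_assoc)
    from compact_attains_inf[OF this] assms(2) obtain d'
      where d': "d' \<in> {c..d}" "v d \<le> v d'" "\<And>s. s \<in> {c..d} \<Longrightarrow> v d \<le> v s \<Longrightarrow> d' \<le> s"
      by fastforce
    have "continuous_on {c..d'} v"
      using cont d'(1) by (auto elim: continuous_on_subset)
    then have "closed ({c..d'} \<inter> v -` {..v c})"
      by (intro continuous_closed_preimage) auto
    then have "compact ({c..d'} \<inter> v -` {..v c})"
      by (metis compact_Icc compact_Int_closed inf.idem inf_assoc)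
    from compact_attains_sup[OF this] d'(1) obtain c'
      where c': "c' \<in> {c..d'}" "v c' \<le> v c" "\<And>s. s \<in> {c..d'} \<Longrightarrow> v s \<le> v c \<Longrightarrow> s \<le> c'"
      by fastforce
    have "v d' - v c' \<le> K * (d' - c')"
      using lipschitz_onD[OF v, of d' c'] c'(1) d'(1) by (auto simp: dist_real_def)
    moreover have "v c < v s \<and> v s < v d" if "s \<in> {c'<..<d'}" for s
    proof -
      have "s \<in> {c..d}" "s \<in> {c..d'}" "\<not> s \<le> c'" "\<not> d' \<le> s"
        using c'(1) d'(1) that by auto
      with c'(3)[of s] d'(3)[of s] show ?thesis by (meson not_le)
    qed
    ultimately show ?thesis
      using c' d' by (intro exI[of _ c'] exI[of _ d']) auto
  qed
  show ?thesis
  proof (cases "v c \<le> v d")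
    case True
    with *[OF assms(1)] that show ?thesis by fastforce
  next
    case False
    have "K-lipschitz_on {c..d} (\<lambda>s. - v s)"
      using assms(1) by (simp add: lipschitz_on_minus)
    from *[OF this] False that show ?thesis by fastforce
  qed
qed

text \<open>The strict inequalities on the middle interval exclude the values 0 and 1, so the bound
  on \<open>g\<close> applies all along it. Integrating over the whole curve while \<open>s\<close>
  and \<open>s'\<close> are arbitrary allows comparison with an intermediate crossing point.\<close>

lemma nn_integral_lipschitz_along:
  fixes \<sigma> :: "real \<Rightarrow> 'a::metric_space"
  assumes \<sigma>: "1-lipschitz_on {0..l} \<sigma>" and w: "K-lipschitz_on UNIV w" "\<And>y. w y \<in> {0..1}"
    and g: "\<And>y. 0 < w y \<Longrightarrow> w y < 1 \<Longrightarrow> ennreal K \<le> g y"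
    and s: "s \<in> {0..l}" "s' \<in> {0..l}"
  shows "ennreal \<bar>w (\<sigma> s) - w (\<sigma> s')\<bar> \<le> (\<integral>\<^sup>+u\<in>{0..l}. g (\<sigma> u) \<partial>lebesgue)"
proof -
  have *: "ennreal \<bar>w (\<sigma> s) - w (\<sigma> s')\<bar> \<le> (\<integral>\<^sup>+u\<in>{0..l}. g (\<sigma> u) \<partial>lebesgue)"
    if "s \<le> s'" "s \<in> {0..l}" "s' \<in> {0..l}" for s s'
  proof -
    have "(K * 1)-lipschitz_on {0..l} (\<lambda>u. w (\<sigma> u))"
      using \<sigma> w(1) by (intro lipschitz_on_compose2) (auto elim: lipschitz_on_subset)
    then have "K-lipschitz_on {s..s'} (\<lambda>u. w (\<sigma> u))"
      using that by (simp, elim lipschitz_on_subset) auto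
    from lipschitz_on_middle_interval[OF this that(1)] obtain c d
      where cd: "s \<le> c" "c \<le> d" "d \<le> s'" "\<bar>w (\<sigma> s) - w (\<sigma> s')\<bar> \<le> K * (d - c)"
      and mid: "\<And>u. u \<in> {c<..<d} \<Longrightarrow>
        min (w (\<sigma> s)) (w (\<sigma> s')) < w (\<sigma> u) \<and> w (\<sigma> u) < max (w (\<sigma> s)) (w (\<sigma> s'))"
      by metis
    have K: "0 \<le> K" using w(1) by (rule lipschitz_on_nonneg)
    have "ennreal \<bar>w (\<sigma> s) - w (\<sigma> s')\<bar> \<le> ennreal K * emeasure lebesgue {c<..<d}"
      using cd K by (simp add: ennreal_mult[symmetric] ennreal_leI)
    also have "\<dots> = (\<integral>\<^sup>+u. ennreal K * indicator {c<..<d} u \<partial>lebesgue)"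
      by (simp add: nn_integral_cmult_indicator)
    also have "\<dots> \<le> (\<integral>\<^sup>+u\<in>{0..l}. g (\<sigma> u) \<partial>lebesgue)"
    proof (rule nn_integral_mono)
      fix u
      show "ennreal K * indicator {c<..<d} u \<le> g (\<sigma> u) * indicator {0..l} u"
      proof (cases "u \<in> {c<..<d}")
        case True
        then have "0 < w (\<sigma> u)" "w (\<sigma> u) < 1"
          using mid[OF True] w(2)[of "\<sigma> s"] w(2)[of "\<sigma> s'"] by (auto simp: min_def max_def split: if_splits)
        moreover have "u \<in> {0..l}" using True cd that by auto
        ultimately show ?thesis using g True by simp
      qed simp
    qed
    finally show ?thesis .
  qed
  show ?thesis
    using *[of s s'] *[of s' s] s by (cases "s \<le> s'") (auto simp: abs_minus_commute)
qed

text \<open>One sequence will hold both the cutoff and the functions attached to the covering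
  balls.\<close>

definition cut_inf :: "'a set \<Rightarrow> (nat \<Rightarrow> 'a \<Rightarrow> real) \<Rightarrow> 'a \<Rightarrow> real" where
  "cut_inf \<Omega> w y = (if y \<in> \<Omega> then INF n. w n y else 0)"

text \<open>The candidate upper gradient of \<open>cut_inf\<close>, with \<open>K n\<close> a
  Lipschitz constant of \<open>w n\<close>. Strict inequalities make it vanish wherever every
  \<open>w n\<close> is 0 or 1.\<close>

definition sup_slope :: "(nat \<Rightarrow> real) \<Rightarrow> (nat \<Rightarrow> 'a \<Rightarrow> real) \<Rightarrow> 'a \<Rightarrow> ennreal" where
  "sup_slope K w y = (SUP n. ennreal (K n) * indicator {z. 0 < w n z \<and> w n z < 1} y)"

lemma bdd_below_unit: "\<forall>n. w n y \<in> {0..1::real} \<Longrightarrow> bdd_below (range (\<lambda>n. w n y))"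
  by (rule bdd_belowI[of _ 0]) auto

lemma cut_inf_bounds:
  assumes "\<And>n y. w n y \<in> {0..1}"
  shows "0 \<le> cut_inf \<Omega> w y" "cut_inf \<Omega> w y \<le> w n y"
    and "w n y = 0 \<Longrightarrow> cut_inf \<Omega> w y = 0"
proof -
  have b: "bdd_below (range (\<lambda>n. w n y))"
    using assms by (intro bdd_below_unit) simp
  show 0: "0 \<le> cut_inf \<Omega> w y"
    unfolding cut_inf_def using assms by (auto intro!: cINF_greatest)
  show 1: "cut_inf \<Omega> w y \<le> w n y"
    unfolding cut_inf_def using assms[of n y] b by (auto intro!: cINF_lower)
  show "w n y = 0 \<Longrightarrow> cut_inf \<Omega> w y = 0"
    using 0 1 by simp
qed

text \<open>Taking infima is 1-Lipschitz for the supremum norm: if all differences are at most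
  \<open>r\<close>, then the infimum of \<open>f\<close> minus \<open>r\<close> is a lower bound for
  \<open>h\<close>, and conversely.\<close>

lemma abs_INF_diff_le:
  fixes f h :: "nat \<Rightarrow> real"
  assumes fh: "\<And>n. ennreal \<bar>f n - h n\<bar> \<le> I" and nn: "\<And>n. 0 \<le> f n" "\<And>n. 0 \<le> h n"
  shows "ennreal \<bar>(INF n. f n) - (INF n. h n)\<bar> \<le> I"
proof (cases I)
  case (real r)
  have le: "(INF n. f n) - r \<le> (INF n. h n)"
    if "\<And>n. \<bar>f n - h n\<bar> \<le> r" "\<And>n. 0 \<le> f n" for f h :: "nat \<Rightarrow> real"
  proof (rule cINF_greatest)
    fix n
    have "(INF n. f n) \<le> f n"
      using that(2) by (intro cINF_lower bdd_belowI[of _ 0]) auto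
    then show "(INF n. f n) - r \<le> h n"
      using that(1)[of n] by linarith
  qed simp
  have "\<bar>f n - h n\<bar> \<le> r" for n
    using fh[of n] real by simp
  then have "\<bar>(INF n. f n) - (INF n. h n)\<bar> \<le> r"
    using le[of f h] le[of h f] nn by (auto simp: abs_minus_commute abs_le_iff)
  then show ?thesis using real by (simp add: ennreal_leI)
qed simp

text \<open>With both ends in \<open>\<Omega>\<close>, the Lipschitz estimate passes to the infimum.
  A curve leaving \<open>\<Omega>\<close> meets the frontier by connectedness; the infimum vanishes
  there, so its value at the end in \<open>\<Omega>\<close> is bounded by its change up to the
  crossing.\<close>

lemma upper_gradient_along_cut_inf:
  assumes w: "\<And>n. (K n)-lipschitz_on UNIV (w n)" "\<And>n y. w n y \<in> {0..1}"
    and fr: "\<And>y. y \<in> frontier \<Omega> \<Longrightarrow> \<exists>n. w n y = 0"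
    and c: "c \<in> curves"
  shows "upper_gradient_along (sup_slope K w) (\<lambda>y. ereal (cut_inf \<Omega> w y)) c"
proof -
  obtain a b \<gamma> where [simp]: "c = (a, b, \<gamma>)" by (cases c)
  have *: "continuous_on {a..b} \<gamma>" "path_length a b \<gamma> < \<infinity>" "a \<le> b"
    using c by (auto simp: curves_def)
  define l where "l = enn2real (path_length a b \<gamma>)"
  define \<sigma> where "\<sigma> = arc_length_param (a, b, \<gamma>)"
  define I where "I = (\<integral>\<^sup>+u\<in>{0..l}. sup_slope K w (\<sigma> u) \<partial>lebesgue)"
  have \<sigma>: "1-lipschitz_on {0..l} \<sigma>"
    unfolding l_def \<sigma>_def by (rule arc_length_param_lipschitz[OF *])
  have l: "0 \<le> l" by (simp add: l_def)
  have slope: "ennreal (K n) \<le> sup_slope K w y" if "0 < w n y" "w n y < 1" for n y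
    unfolding sup_slope_def using that by (intro SUP_upper2[of n]) auto
  have inf: "ennreal \<bar>(INF n. w n (\<sigma> s)) - (INF n. w n (\<sigma> s'))\<bar> \<le> I"
    if "s \<in> {0..l}" "s' \<in> {0..l}" for s s'
    unfolding I_def using that w slope
    by (intro abs_INF_diff_le nn_integral_lipschitz_along[OF \<sigma>]) auto
  have zero: "cut_inf \<Omega> w y = 0" if "y \<notin> \<Omega>" for y
    using that by (simp add: cut_inf_def)
  have cross: "ennreal (cut_inf \<Omega> w (\<sigma> s)) \<le> I"
    if "\<sigma> s \<in> \<Omega>" "\<sigma> s' \<notin> \<Omega>" "s \<in> {0..l}" "s' \<in> {0..l}" for s s'
  proof -
    have "connected (\<sigma> ` {0..l})"
      by (intro connected_continuous_image lipschitz_on_continuous_on[OF \<sigma>]) simp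
    from connected_Int_frontier[OF this, of \<Omega>] that
    obtain u where u: "u \<in> {0..l}" "\<sigma> u \<in> frontier \<Omega>" by blast
    from fr[OF u(2)] obtain n where "w n (\<sigma> u) = 0" by blast
    then have "(INF n. w n (\<sigma> u)) = 0"
      using cut_inf_bounds(3)[where \<Omega> = UNIV and w = w] w(2) by (simp add: cut_inf_def)
    with inf[OF that(3) u(1)] have "ennreal \<bar>INF n. w n (\<sigma> s)\<bar> \<le> I" by simp
    moreover have "(INF n. w n (\<sigma> s)) \<ge> 0"
      using w(2) by (intro cINF_greatest) auto
    ultimately show ?thesis using that(1) by (simp add: cut_inf_def)
  qed
  have "ennreal \<bar>cut_inf \<Omega> w (\<sigma> 0) - cut_inf \<Omega> w (\<sigma> l)\<bar> \<le> I"
  proof (cases "\<sigma> 0 \<in> \<Omega>"; cases "\<sigma> l \<in> \<Omega>")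
    assume "\<sigma> 0 \<in> \<Omega>" "\<sigma> l \<in> \<Omega>"
    then show ?thesis using inf[of 0 l] l by (simp add: cut_inf_def)
  next
    assume "\<sigma> 0 \<in> \<Omega>" "\<sigma> l \<notin> \<Omega>"
    then show ?thesis
      using cross[of 0 l] l zero cut_inf_bounds(1)[where w = w] w(2) by simp
  next
    assume "\<sigma> 0 \<notin> \<Omega>" "\<sigma> l \<in> \<Omega>"
    then show ?thesis
      using cross[of l 0] l zero cut_inf_bounds(1)[where w = w] w(2) by simp
  qed (use zero in simp)
  moreover have "\<sigma> 0 = \<gamma> a" "\<sigma> l = \<gamma> b"
    unfolding l_def \<sigma>_def using arc_length_param_endpoints[OF *] by auto
  moreover have "I = line_integral (a, b, \<gamma>) (sup_slope K w)"
    by (simp add: I_def line_integral_def l_def \<sigma>_def)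
  ultimately show ?thesis
    by (simp add: upper_gradient_along_def)
qed

section \<open>Powers in \<open>[0,\<infinity>]\<close> and the energy of the slope\<close>

lemma enn_powr_ennreal: "0 \<le> x \<Longrightarrow> enn_powr (ennreal x) p = ennreal (x powr p)"
  by (simp add: enn_powr_def)

lemma enn_powr_0 [simp]: "enn_powr 0 p = 0"
  using enn_powr_ennreal[of 0 p] by simp

lemma enn_powr_mono: "0 \<le> p \<Longrightarrow> x \<le> y \<Longrightarrow> enn_powr x p \<le> enn_powr y p"
  by (cases x; cases y) (auto simp: enn_powr_ennreal powr_mono2 ennreal_leI enn_powr_def top_unique)

text \<open>If the sum is a finite number \<open>S\<close>, it bounds each of its terms; so every
  \<open>f n\<close>, and with them the supremum, is at most \<open>S powr (1 / p)\<close>.\<close>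

lemma enn_powr_SUP_le_suminf:
  assumes "0 < p"
  shows "enn_powr (SUP n::nat. f n) p \<le> (\<Sum>n. enn_powr (f n) p)"
proof (cases "\<Sum>n. enn_powr (f n) p")
  case (real S)
  have "f n \<le> ennreal (S powr (1 / p))" for n
  proof -
    have "(\<Sum>i<Suc n. enn_powr (f i) p) \<le> (\<Sum>n. enn_powr (f n) p)"
      by (intro sum_le_suminf) auto
    then have "enn_powr (f n) p \<le> ennreal S"
      using real by (auto intro: order_trans[rotated])
    then obtain x where x: "0 \<le> x" "f n = ennreal x" "x powr p \<le> S"
      using real by (cases "f n") (auto simp: enn_powr_ennreal enn_powr_def top_unique)
    then have "(x powr p) powr (1 / p) \<le> S powr (1 / p)"
      using assms by (intro powr_mono2) auto
    then show ?thesis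
      using x assms by (simp add: powr_powr ennreal_leI)
  qed
  then have "enn_powr (SUP n. f n) p \<le> enn_powr (ennreal (S powr (1 / p))) p"
    using assms by (intro enn_powr_mono SUP_least) auto
  also have "\<dots> = ennreal S"
    using assms real by (simp add: enn_powr_ennreal powr_powr)
  finally show ?thesis using real by simp
qed simp

context
  fixes mu :: "'a::metric_space set \<Rightarrow> ennreal"
  assumes reg: "borel_regular_outer_measure mu"
begin

lemma outer_measure_space_mu: "outer_measure_space UNIV mu"
  using reg by (simp add: borel_regular_outer_measure_def)

lemma mu_mono: "A \<subseteq> B \<Longrightarrow> mu A \<le> mu B"
  using outer_measure_space_mu by (auto simp: outer_measure_space_def increasing_def)

lemma sets_induced_borel: "A \<in> sets borel \<Longrightarrow> A \<in> sets (induced_measure mu)"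
  using reg by (auto simp: borel_regular_outer_measure_def sets_induced_measure)

lemma emeasure_induced_borel: "A \<in> sets borel \<Longrightarrow> emeasure (induced_measure mu) A = mu A"
  using sets_induced_borel outer_measure_space_mu by (metis emeasure_induced_measure sets_induced_measure)

lemma measurable_induced_borel:
  "f \<in> measurable borel N \<Longrightarrow> f \<in> measurable (induced_measure mu) N"
  using sets_induced_borel
  by (auto simp: measurable_def space_induced_measure[OF outer_measure_space_mu])

text \<open>The exceptional family is empty; its modulus is zero because the zero density is
  admissible for it.\<close>

lemma weak_upper_gradient_cut_inf:
  assumes w: "\<And>n. (K n)-lipschitz_on UNIV (w n)" "\<And>n y. w n y \<in> {0..1}"
    and fr: "\<And>y. y \<in> frontier \<Omega> \<Longrightarrow> \<exists>n. w n y = 0"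
  shows "weak_upper_gradient mu p (sup_slope K w) (\<lambda>y. ereal (cut_inf \<Omega> w y))"
proof -
  have [measurable]: "w n \<in> borel_measurable borel" for n
    by (intro borel_measurable_continuous_onI lipschitz_on_continuous_on[OF w(1)])
  have "sup_slope K w \<in> borel_measurable borel"
    unfolding sup_slope_def by measurable
  moreover have "p_modulus mu p {} = 0"
    unfolding p_modulus_def by (rule le_zero_eq[THEN iffD1], rule INF_lower2[of "\<lambda>_. 0"]) auto
  ultimately show ?thesis
    unfolding weak_upper_gradient_def using upper_gradient_along_cut_inf[OF w fr]
    by (auto intro: measurable_induced_borel exI[of _ "{}"])
qed

lemma nn_integral_sup_slope_le:
  assumes w: "\<And>n. (K n)-lipschitz_on UNIV (w n)" and p: "0 < p" and B: "B \<in> sets borel"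
  shows "(\<integral>\<^sup>+y\<in>B. enn_powr (sup_slope K w y) p \<partial>induced_measure mu)
    \<le> (\<Sum>n. ennreal (K n powr p) * mu ({y. 0 < w n y \<and> w n y < 1} \<inter> B))"
proof -
  have [measurable]: "w n \<in> borel_measurable borel" for n
    by (intro borel_measurable_continuous_onI lipschitz_on_continuous_on[OF w])
  note B[measurable]
  have m: "{y. 0 < w n y \<and> w n y < 1} \<inter> B \<in> sets borel" for n
    by measurable
  have K: "0 \<le> K n" for n using w by (rule lipschitz_on_nonneg)
  have "(\<integral>\<^sup>+y\<in>B. enn_powr (sup_slope K w y) p \<partial>induced_measure mu)
      \<le> (\<integral>\<^sup>+y. (\<Sum>n. ennreal (K n powr p) * indicator ({y. 0 < w n y \<and> w n y < 1} \<inter> B) y)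
        \<partial>induced_measure mu)"
  proof (rule nn_integral_mono)
    fix y
    have "enn_powr (ennreal (K n) * indicator {z. 0 < w n z \<and> w n z < 1} y) p
        = ennreal (K n powr p) * indicator {z. 0 < w n z \<and> w n z < 1} y" for n
      using K by (simp add: indicator_def enn_powr_ennreal)
    with enn_powr_SUP_le_suminf[OF p, of "\<lambda>n. ennreal (K n) * indicator {z. 0 < w n z \<and> w n z < 1} y"]
    have "enn_powr (sup_slope K w y) p
        \<le> (\<Sum>n. ennreal (K n powr p) * indicator {z. 0 < w n z \<and> w n z < 1} y)"
      by (simp add: sup_slope_def)
    then show "enn_powr (sup_slope K w y) p * indicator B y
        \<le> (\<Sum>n. ennreal (K n powr p) * indicator ({y. 0 < w n y \<and> w n y < 1} \<inter> B) y)"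
      by (cases "y \<in> B") (simp_all add: indicator_inter_arith)
  qed
  also have "\<dots> = (\<Sum>n. ennreal (K n powr p) * mu ({y. 0 < w n y \<and> w n y < 1} \<inter> B))"
    using sets_induced_borel[OF m]
    by (subst nn_integral_suminf)
      (simp_all only: nn_integral_cmult_indicator emeasure_induced_borel[OF m]
        borel_measurable_times_ennreal borel_measurable_const borel_measurable_indicator)
  finally show ?thesis .
qed

end

section \<open>The content estimate\<close>

text \<open>Covers are indexed by a set of naturals and summed by \<open>infsum\<close>, whereas the
  slopes form a sequence; padding by zeros links the two.\<close>

lemma suminf_restrict_le_infsum:
  fixes f :: "nat \<Rightarrow> ennreal"
  assumes "J \<subseteq> I"
  shows "(\<Sum>n. if n \<in> J then f n else 0) \<le> infsum f I"
proof (rule suminf_le_const)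
  fix n
  have "(\<Sum>i<n. if i \<in> J then f i else 0) = infsum f ({..<n} \<inter> J)"
    by (simp add: sum.inter_restrict)
  also have "\<dots> \<le> infsum f I"
    using assms by (intro infsum_mono_neutral nonneg_summable_on_complete) auto
  finally show "(\<Sum>i<n. if i \<in> J then f i else 0) \<le> infsum f I" .
qed simp

lemma suminf_split_head_ennreal: "(\<Sum>n. f n) = (\<Sum>n. f (Suc n)) + (f 0 :: ennreal)"
  by (rule sums_unique[symmetric]) (intro sums_Suc summable_sums summableI)

lemma ball_doubling_power:
  assumes cD: "0 \<le> cD" "\<And>x r. 0 < r \<Longrightarrow> mu (ball x (2 * r)) \<le> ennreal cD * mu (ball x r)"
    and "0 < r"
  shows "mu (ball x (2 ^ k * r)) \<le> ennreal (cD ^ k) * mu (ball x r)"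
proof (induction k)
  case (Suc k)
  have "mu (ball x (2 ^ Suc k * r)) \<le> ennreal cD * mu (ball x (2 ^ k * r))"
    using cD(2)[of "2 ^ k * r" x] \<open>0 < r\<close> by (simp add: mult.assoc)
  also have "\<dots> \<le> ennreal cD * (ennreal (cD ^ k) * mu (ball x r))"
    by (intro mult_left_mono Suc) simp
  finally show ?case using cD(1) by (simp add: ennreal_mult mult.assoc)
qed simp

abbreviation clamp01 :: "real \<Rightarrow> real" where
  "clamp01 t \<equiv> max 0 (min 1 t)"

lemma lipschitz_on_clamp01_dist:
  assumes "0 \<le> K" and "\<bar>b\<bar> = K"
  shows "K-lipschitz_on UNIV (\<lambda>z. clamp01 (a + b * dist z c))"
proof (rule lipschitz_onI)
  fix y z
  have "\<bar>clamp01 (a + b * dist y c) - clamp01 (a + b * dist z c)\<bar> \<le> \<bar>b * dist y c - b * dist z c\<bar>"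
    by (simp add: max_def min_def)
  also have "\<dots> = K * \<bar>dist y c - dist z c\<bar>"
    using assms by (simp add: abs_mult flip: right_diff_distrib)
  also have "\<dots> \<le> K * dist y z"
    using assms(1) by (intro mult_left_mono) (use dist_triangle[of y c z] dist_triangle[of z c y] in \<open>auto simp: dist_commute abs_le_iff\<close>)
  finally show "dist (clamp01 (a + b * dist y c)) (clamp01 (a + b * dist z c)) \<le> K * dist y z"
    by (simp add: dist_real_def)
qed (rule assms)

text \<open>The estimate for a single cover. The bounds on \<open>C\<close> serve the case of a ball
  of radius at least \<open>\<delta> / 8\<close> and the case of small balls; \<open>k\<close>
  counts the doublings that inflate a large ball until it contains
  \<open>cball x \<delta>\<close>.\<close>

lemma frontier_content_sum_ge:
  fixes mu :: "'a::metric_space set \<Rightarrow> ennreal" and I :: "nat set" and r :: "nat \<Rightarrow> real"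
  assumes p: "1 \<le> p" and reg: "borel_regular_outer_measure mu"
    and fin: "\<And>x r. 0 < r \<Longrightarrow> 0 < mu (ball x r) \<and> mu (ball x r) < \<infinity>"
    and cD: "1 \<le> cD" "\<And>x r. 0 < r \<Longrightarrow> mu (ball x (2 * r)) \<le> ennreal cD * mu (ball x r)"
    and \<Omega>: "open \<Omega>" and L: "1 \<le> L" and k: "40 * L \<le> 2 ^ k" and cH: "0 < cH"
    and hardy: "pointwise_hardy mu p \<Omega> cH L"
    and x: "x \<in> \<Omega>" and \<delta>: "\<delta> = boundary_dist \<Omega> x" "0 < \<delta>"
    and cover: "frontier \<Omega> \<inter> cball x (2 * L * \<delta>) \<subseteq> (\<Union>i\<in>I. ball (c i) (r i))"
    and r: "\<And>i. i \<in> I \<Longrightarrow> 0 < r i \<and> r i \<le> \<delta>"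
    and C: "0 < C" "C * cD ^ k \<le> 1" "C * (cD ^ 4 * (5 / 4 * cH) powr p) \<le> 1"
  shows "ennreal (C * \<delta> powr (- p)) * mu (cball x \<delta>)
    \<le> (\<Sum>\<^sub>\<infinity>i\<in>I. mu (ball (c i) (r i)) * ennreal (r i powr (- p)))"
proof -
  define N where "N = induced_measure mu"
  define s where "s i = mu (ball (c i) (r i)) * ennreal (r i powr (- p))" for i
  define E where "E = frontier \<Omega> \<inter> cball x (2 * L * \<delta>)"
  \<comment> \<open>Every ball kept contains a boundary point. This bounds the distance of its
    centre from \<open>x\<close> from above in the first case and from below in the second.\<close>
  define J where "J = {i \<in> I. ball (c i) (r i) \<inter> E \<noteq> {}}"
  have J: "J \<subseteq> I" and rJ: "\<And>i. i \<in> J \<Longrightarrow> 0 < r i"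
    using r by (auto simp: J_def)
  have EJ: "E \<subseteq> (\<Union>i\<in>J. ball (c i) (r i))"
    using cover by (fastforce simp: J_def E_def)
  define S where "S = (\<Sum>n. if n \<in> J then s n else 0)"
  have S_le: "S \<le> infsum s I"
    unfolding S_def by (rule suminf_restrict_le_infsum[OF J])
  have L\<delta>: "\<delta> \<le> L * \<delta>"
    using L \<delta>(2) by simp
  have "ennreal (C * \<delta> powr (- p)) * mu (cball x \<delta>) \<le> infsum s I"
  proof (cases "\<exists>i\<in>J. \<delta> / 8 \<le> r i")

    \<comment> \<open>Case of a ball of radius at least \<open>\<delta> / 8\<close>\<close>
    case True
    then obtain i where i: "i \<in> J" "\<delta> / 8 \<le> r i" by blast
    then obtain e where e: "dist (c i) e < r i" "e \<in> E" by (auto simp: J_def)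
    have ri: "0 < r i" "r i \<le> \<delta>" using i(1) J r by auto
    \<comment> \<open>Going through \<open>e\<close> gives a distance below
      \<open>5 * L * \<delta>\<close>, and \<open>\<delta> \<le> 8 * r i\<close> turns this into
      \<open>40 * L * r i\<close>.\<close>
    have "cball x \<delta> \<subseteq> ball (c i) (2 ^ k * r i)"
    proof
      fix z assume z: "z \<in> cball x \<delta>"
      have "dist (c i) z \<le> dist (c i) e + dist x e + dist x z"
        by metric
      also have "\<dots> < \<delta> + 2 * L * \<delta> + \<delta>"
        using e z ri by (auto simp: E_def)
      also have "\<dots> \<le> 5 * L * \<delta>" using L\<delta> \<delta>(2) by simp
      also have "\<dots> \<le> 40 * L * r i"
        using i(2) L by (simp add: field_simps)
      also have "\<dots> \<le> 2 ^ k * r i"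
        using k ri by (intro mult_right_mono) auto
      finally show "z \<in> ball (c i) (2 ^ k * r i)" by simp
    qed
    then have "mu (cball x \<delta>) \<le> mu (ball (c i) (2 ^ k * r i))"
      by (rule mu_mono[OF reg])
    also have "\<dots> \<le> ennreal (cD ^ k) * mu (ball (c i) (r i))"
      using cD ri by (intro ball_doubling_power) auto
    finally have "ennreal (C * \<delta> powr (- p)) * mu (cball x \<delta>)
        \<le> ennreal (C * \<delta> powr (- p)) * (ennreal (cD ^ k) * mu (ball (c i) (r i)))"
      by (intro mult_left_mono) simp_all
    also have "\<dots> = ennreal ((C * cD ^ k) * \<delta> powr (- p)) * mu (ball (c i) (r i))"
      using C(1) cD(1) by (simp add: ennreal_mult mult_ac)
    also have "\<dots> \<le> ennreal (r i powr (- p)) * mu (ball (c i) (r i))"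
    proof (intro mult_right_mono ennreal_leI)
      have "(C * cD ^ k) * \<delta> powr (- p) \<le> \<delta> powr (- p)"
        using C(2) by (intro mult_left_le_one_le) (use C(1) cD(1) in auto)
      also have "\<dots> \<le> r i powr (- p)"
        using ri p by (intro powr_mono2') auto
      finally show "(C * cD ^ k) * \<delta> powr (- p) \<le> r i powr (- p)" .
    qed simp
    also have "\<dots> = infsum s {i}"
      by (simp add: s_def mult.commute)
    also have "\<dots> \<le> infsum s I"
      using i(1) J by (intro infsum_mono_neutral nonneg_summable_on_complete) auto
    finally show ?thesis .
  next

    \<comment> \<open>Case of small balls: the test function\<close>
    case False
    then have small: "r i < \<delta> / 8" if "i \<in> J" for i using that by force
    show ?thesis
    \<comment> \<open>Finiteness of \<open>S\<close> will give the test function finite energy; if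
      \<open>S\<close> is infinite, so is the right-hand side.\<close>
    proof (cases "S = \<infinity>")
      case True
      then show ?thesis using S_le by (simp add: top_unique)
    next
      case S_fin: False
      \<comment> \<open>Index 0 is the cutoff, equal to 1 up to distance
        \<open>3 / 2 * L * \<delta>\<close> from \<open>x\<close> and to 0 from
        \<open>2 * L * \<delta>\<close> on. Index \<open>Suc i\<close> is 0 up to distance
        \<open>r i\<close> from \<open>c i\<close> and 1 from \<open>2 * r i\<close> on; for
        \<open>i\<close> outside \<open>J\<close> the constant 1 does not affect the
        infimum.\<close>
      define w where "w n z = (case n of 0 \<Rightarrow> clamp01 (4 + - (2 / (L * \<delta>)) * dist z x)
        | Suc i \<Rightarrow> if i \<in> J then clamp01 (- 1 + 1 / r i * dist z (c i)) else 1)" for n z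
      define K where "K n = (case n of 0 \<Rightarrow> 2 / (L * \<delta>) | Suc i \<Rightarrow> if i \<in> J then 1 / r i else 0)" for n
      define A where "A n = {z. 0 < w n z \<and> w n z < 1}" for n
      define u where "u = (\<lambda>y. ereal (cut_inf \<Omega> w y))"
      define g where "g = sup_slope K w"
      have w01: "w n z \<in> {0..1}" for n z
        by (auto simp: w_def split: nat.split)
      have wK: "(K n)-lipschitz_on UNIV (w n)" for n
      proof (cases n)
        case 0
        then show ?thesis
          using L \<delta>(2) unfolding w_def K_def by (simp only: nat.case) (intro lipschitz_on_clamp01_dist; simp)
      next
        case (Suc i)
        then show ?thesis
        proof (cases "i \<in> J")
          case True
          then show ?thesis
            using rJ[of i] Suc unfolding w_def K_def
            by (simp only: nat.case if_True) (intro lipschitz_on_clamp01_dist; simp)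
        qed (auto simp: w_def K_def lipschitz_on_def)
      qed
      have A0: "A 0 \<subseteq> ball x (2 * L * \<delta>)" and A0': "A 0 \<inter> ball x (3 / 2 * L * \<delta>) = {}"
        using L \<delta>(2) by (auto simp: A_def w_def less_max_iff_disj min_less_iff_disj dist_commute field_simps)
      have ASuc: "A (Suc i) \<subseteq> (if i \<in> J then ball (c i) (2 * r i) else {})" for i
        using rJ[of i]
        by (auto simp: A_def w_def less_max_iff_disj min_less_iff_disj dist_commute field_simps)
      \<comment> \<open>The boundary point \<open>e\<close> has distance at least
        \<open>\<delta>\<close> from \<open>x\<close>, so \<open>c i\<close> is more than
        \<open>3 / 8 * \<delta>\<close> away from \<open>z\<close>, while
        \<open>2 * r i < \<delta> / 4\<close>.\<close>
      have w1: "w n z = 1" if z: "z \<in> ball x (\<delta> / 2)" for n z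
      proof (cases n)
        case 0
        have "dist x z * 2 \<le> 3 * (L * \<delta>)" using z L\<delta> \<delta>(2) unfolding mem_ball by linarith
        then show ?thesis using 0 L \<delta>(2) by (simp add: w_def dist_commute field_simps)
      next
        case (Suc i)
        show ?thesis
        proof (cases "i \<in> J")
          case True
          then obtain e where e: "dist (c i) e < r i" "e \<in> frontier \<Omega>" by (auto simp: J_def E_def)
          have "\<delta> \<le> dist x e"
            unfolding \<delta> boundary_dist_def by (rule infdist_le[OF e(2)])
          also have "\<dots> \<le> dist x z + dist z (c i) + dist (c i) e" by metric
          finally have "2 * r i \<le> dist z (c i)"
            using e(1) z small[OF True] rJ[OF True] by simp
          then show ?thesis using rJ[OF True] True Suc by (simp add: w_def field_simps)
        qed (simp add: Suc w_def)
      qed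
      have w0: "w 0 y = 0" if "2 * L * \<delta> \<le> dist x y" for y
      proof -
        have "4 + - (2 / (L * \<delta>)) * dist y x \<le> 0"
          using that L \<delta>(2) by (simp add: dist_commute field_simps)
        then show ?thesis by (simp add: w_def)
      qed
      have fr: "\<exists>n. w n y = 0" if y: "y \<in> frontier \<Omega>" for y
      proof (cases "dist x y \<le> 2 * L * \<delta>")
        case True
        then obtain i where "i \<in> J" "dist (c i) y < r i" using EJ y by (auto simp: E_def)
        then show ?thesis
          using rJ[of i] by (intro exI[of _ "Suc i"]) (simp add: w_def dist_commute field_simps)
      next
        case False
        then show ?thesis by (intro exI[of _ 0] w0) simp
      qed

      \<comment> \<open>Energy of the upper gradient and Sobolev membership\<close>
      have wug: "weak_upper_gradient mu p g u"
        unfolding g_def u_def by (rule weak_upper_gradient_cut_inf[OF reg wK w01 fr])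
      \<comment> \<open>The slope \<open>1 / r n\<close> to the power \<open>p\<close> is the weight
        in \<open>s n\<close>, and it acts inside the doubled ball, so the balls contribute at most
        \<open>cD * S\<close>. The cutoff term stays separate: it is finite on the whole space and
        will vanish on the balls seen by the maximal function.\<close>
      have int_g: "(\<integral>\<^sup>+y\<in>B. enn_powr (g y) p \<partial>N)
          \<le> ennreal cD * S + ennreal (K 0 powr p) * mu (A 0 \<inter> B)" if B: "B \<in> sets borel" for B
      proof -
        have *: "ennreal (K (Suc n) powr p) * mu (A (Suc n) \<inter> B)
            \<le> ennreal cD * (if n \<in> J then s n else 0)" for n
        proof (cases "n \<in> J")
          case True
          have "mu (A (Suc n) \<inter> B) \<le> mu (ball (c n) (2 * r n))"
            using ASuc[of n] True by (intro mu_mono[OF reg]) auto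
          also have "\<dots> \<le> ennreal cD * mu (ball (c n) (r n))"
            using rJ[OF True] by (rule cD(2))
          finally have "ennreal (K (Suc n) powr p) * mu (A (Suc n) \<inter> B)
              \<le> ennreal (K (Suc n) powr p) * (ennreal cD * mu (ball (c n) (r n)))"
            by (intro mult_left_mono) simp_all
          moreover have "K (Suc n) powr p = r n powr (- p)"
            using True rJ[OF True] by (simp add: K_def powr_minus_divide powr_divide)
          ultimately show ?thesis using True by (simp add: s_def mult_ac)
        qed (use p in \<open>simp add: K_def\<close>)
        have "(\<integral>\<^sup>+y\<in>B. enn_powr (g y) p \<partial>N) \<le> (\<Sum>n. ennreal (K n powr p) * mu (A n \<inter> B))"
          unfolding g_def A_def N_def using p by (intro nn_integral_sup_slope_le[OF reg wK _ B]) simp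
        also have "\<dots> = (\<Sum>n. ennreal (K (Suc n) powr p) * mu (A (Suc n) \<inter> B))
            + ennreal (K 0 powr p) * mu (A 0 \<inter> B)"
          by (rule suminf_split_head_ennreal)
        also have "\<dots> \<le> (\<Sum>n. ennreal cD * (if n \<in> J then s n else 0))
            + ennreal (K 0 powr p) * mu (A 0 \<inter> B)"
          by (intro add_right_mono suminf_le * summableI)
        also have "(\<Sum>n. ennreal cD * (if n \<in> J then s n else 0)) = ennreal cD * S"
          by (simp add: S_def ennreal_suminf_cmult)
        finally show ?thesis .
      qed
      have u_sob: "u \<in> sobolev0 mu p \<Omega>"
      proof -
        have wm [measurable]: "w n \<in> borel_measurable borel" for n
          by (intro borel_measurable_continuous_onI lipschitz_on_continuous_on[OF wK])
        have [measurable]: "\<Omega> \<in> sets borel" using \<Omega> by simp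
        have "(\<lambda>y. INF n. w n y) \<in> borel_measurable borel"
          using bdd_below_unit[of w] w01 by (intro borel_measurable_cINF_real wm) auto
        then have "u \<in> borel_measurable borel"
          unfolding u_def cut_inf_def by measurable
        then have "u \<in> borel_measurable (induced_measure mu)"
          by (rule measurable_induced_borel[OF reg])
        moreover have "(\<integral>\<^sup>+y. enn_powr (e2ennreal \<bar>u y\<bar>) p \<partial>N) < \<infinity>"
        proof -
          have "(\<integral>\<^sup>+y. enn_powr (e2ennreal \<bar>u y\<bar>) p \<partial>N) \<le> (\<integral>\<^sup>+y. indicator (ball x (2 * L * \<delta>)) y \<partial>N)"
          proof (rule nn_integral_mono)
            fix y
            have b: "0 \<le> cut_inf \<Omega> w y" "cut_inf \<Omega> w y \<le> w 0 y"
              using cut_inf_bounds[of w] w01 by auto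
            have "cut_inf \<Omega> w y \<le> 1" using b(2) w01[of 0 y] by simp
            moreover have "cut_inf \<Omega> w y = 0" if "y \<notin> ball x (2 * L * \<delta>)"
            proof -
              have "w 0 y = 0"
                using that by (intro w0) simp
              then show ?thesis using b by simp
            qed
            ultimately show "enn_powr (e2ennreal \<bar>u y\<bar>) p \<le> indicator (ball x (2 * L * \<delta>)) y"
              using b(1) p by (auto simp: u_def indicator_def enn_powr_ennreal powr_le_one_le
                  intro: order_trans[OF powr_mono2[of p _ 1]])
          qed
          also have "\<dots> = mu (ball x (2 * L * \<delta>))"
            unfolding N_def by (simp add: sets_induced_borel[OF reg] emeasure_induced_borel[OF reg])
          also have "\<dots> < \<infinity>" using fin L \<delta>(2) by simp
          finally show ?thesis .
        qed
        moreover have "(\<integral>\<^sup>+y. enn_powr (g y) p \<partial>N) < \<infinity>"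
        proof -
          have "(\<integral>\<^sup>+y. enn_powr (g y) p \<partial>N) \<le> ennreal cD * S + ennreal (K 0 powr p) * mu (A 0)"
            using int_g[of UNIV] by simp
          also have "\<dots> < \<infinity>"
          proof -
            have "mu (A 0) < \<infinity>"
              using mu_mono[OF reg A0] fin[of "2 * L * \<delta>" x] L \<delta>(2) by (auto intro: le_less_trans)
            moreover have "S < \<infinity>" using S_fin by (metis infinity_ennreal_def top.not_eq_extremum)
            ultimately show ?thesis by (simp add: ennreal_mult_less_top)
          qed
          finally show ?thesis .
        qed
        ultimately show ?thesis
          using wug by (auto simp: sobolev0_def sobolev_def N_def u_def cut_inf_def)
      qed

      \<comment> \<open>A point near \<open>x\<close> where the Hardy inequality holds\<close>
      obtain \<epsilon> where \<epsilon>: "0 < \<epsilon>" "ball x \<epsilon> \<subseteq> \<Omega>" "\<epsilon> \<le> \<delta> / 4"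
      proof -
        obtain e where "0 < e" "ball x e \<subseteq> \<Omega>" using \<Omega> x by (auto simp: open_contains_ball)
        then show ?thesis using \<delta>(2) by (intro that[of "min e (\<delta> / 4)"]) auto
      qed
      have ae: "AE y in N. y \<in> \<Omega> \<longrightarrow> e2ennreal \<bar>u y\<bar> \<le> ennreal (cH * boundary_dist \<Omega> y) *
          enn_powr (maximal_function mu (L * boundary_dist \<Omega> y) (\<lambda>z. enn_powr (g z) p) y) (1 / p)"
        using hardy u_sob wug unfolding pointwise_hardy_def N_def by blast
      \<comment> \<open>The ball has positive measure, so a property valid almost everywhere holds
        somewhere in it.\<close>
      obtain y where y: "y \<in> ball x \<epsilon>"
        and le: "e2ennreal \<bar>u y\<bar> \<le> ennreal (cH * boundary_dist \<Omega> y) *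
          enn_powr (maximal_function mu (L * boundary_dist \<Omega> y) (\<lambda>z. enn_powr (g z) p) y) (1 / p)"
      proof (rule ccontr)
        assume "\<not> thesis"
        then have "AE y in N. y \<notin> ball x \<epsilon>"
          using ae that \<epsilon>(2) by (auto elim!: eventually_mono)
        then have "emeasure N {y \<in> space N. y \<in> ball x \<epsilon>} = 0"
          by (rule emeasure_eq_0_AE)
        moreover have "{y \<in> space N. y \<in> ball x \<epsilon>} = ball x \<epsilon>"
          by (simp only: N_def space_induced_measure[OF outer_measure_space_mu[OF reg]]) blast
        ultimately have "mu (ball x \<epsilon>) = 0"
          by (simp only: N_def) (simp add: emeasure_induced_borel[OF reg])
        then show False using fin[of \<epsilon> x] \<epsilon>(1) by simp
      qed
      have y\<Omega>: "y \<in> \<Omega>" using y \<epsilon> by blast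
      have dxy: "dist x y < \<delta> / 4" using y \<epsilon> by simp
      \<comment> \<open>The distance to the frontier is 1-Lipschitz, and \<open>y\<close> is within
        \<open>\<delta> / 4\<close> of \<open>x\<close>.\<close>
      have "boundary_dist \<Omega> y \<le> 5 / 4 * \<delta>"
        using infdist_triangle[of y "frontier \<Omega>" x] dxy \<delta>(1)
        by (simp add: boundary_dist_def dist_commute)
      moreover have "0 \<le> boundary_dist \<Omega> y" by (simp add: boundary_dist_def infdist_nonneg)
      ultimately have bd: "cH * boundary_dist \<Omega> y \<le> cH * (5 / 4 * \<delta>)"
          "L * boundary_dist \<Omega> y \<le> L * (5 / 4 * \<delta>)"
        using cH L by auto
      have u1: "u y = 1"
        using w1[of y] dxy \<delta>(2) y\<Omega> by (simp add: u_def cut_inf_def)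

      \<comment> \<open>Bound for the maximal function\<close>
      obtain m where m: "mu (cball x \<delta>) = ennreal m" "0 < m"
      proof -
        have "mu (ball x \<delta>) \<le> mu (cball x \<delta>)" "mu (cball x \<delta>) \<le> mu (ball x (2 * \<delta>))"
          using \<delta>(2) by (auto intro!: mu_mono[OF reg])
        then have "0 < mu (cball x \<delta>)" "mu (cball x \<delta>) < \<infinity>"
          using fin[of \<delta> x] fin[of "2 * \<delta>" x] \<delta>(2) by auto
        then show ?thesis by (cases "mu (cball x \<delta>)") (auto intro: that)
      qed
      obtain S' where S': "S = ennreal S'" "0 \<le> S'" using S_fin by (cases S) auto
      \<comment> \<open>One factor \<open>cD\<close> comes from the doubled balls in the energy
        bound, three from comparing \<open>cball x \<delta>\<close> with the ball of radius
        \<open>\<delta> / 4\<close> about \<open>y\<close>.\<close>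
      define t where "t = cD ^ 4 * S' / m"
      have t0: "0 \<le> t" using S'(2) m(2) cD(1) by (simp add: t_def)
      have "average mu (ball y \<rho>) (\<lambda>z. enn_powr (g z) p) \<le> ennreal t"
        if \<rho>: "0 < \<rho>" "\<rho> \<le> L * boundary_dist \<Omega> y" for \<rho>
      \<comment> \<open>Balls this small lie in \<open>ball x (\<delta> / 2)\<close>, where every
        \<open>w n\<close> is 1 and the slope vanishes.\<close>
      proof (cases "\<rho> \<le> \<delta> / 4")
        case True
        have "enn_powr (g z) p * indicator (ball y \<rho>) z = 0" for z
        proof (cases "z \<in> ball y \<rho>")
          case in_ball: True
          have "dist x z \<le> dist x y + dist y z" by metric
          then have "z \<in> ball x (\<delta> / 2)" using in_ball True dxy by simp
          then have "g z = 0" by (simp add: g_def sup_slope_def w1)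
          then show ?thesis by simp
        qed simp
        then have "(\<integral>\<^sup>+z\<in>ball y \<rho>. enn_powr (g z) p \<partial>induced_measure mu) = 0"
          by (simp only:) simp
        then show ?thesis by (simp add: average_def)
      next
        case False
        \<comment> \<open>The radius is at most \<open>5 / 4 * L * \<delta>\<close> and
          \<open>dist x y < \<delta> / 4 \<le> L * \<delta> / 4\<close>, so the ball stays where the
          cutoff is 1.\<close>
        have "ball y \<rho> \<subseteq> ball x (3 / 2 * L * \<delta>)"
        proof
          fix z assume "z \<in> ball y \<rho>"
          moreover have "dist x z \<le> dist x y + dist y z" by metric
          ultimately show "z \<in> ball x (3 / 2 * L * \<delta>)"
            using dxy \<rho>(2) bd(2) L\<delta> unfolding mem_ball by linarith
        qed
        then have A0B: "A 0 \<inter> ball y \<rho> = {}" using A0' by blast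
        have "mu {} = 0" using outer_measure_space_mu[OF reg] by (simp add: outer_measure_space_def positive_def)
        then have int: "(\<integral>\<^sup>+z\<in>ball y \<rho>. enn_powr (g z) p \<partial>N) \<le> ennreal (cD * S')"
          using int_g[of "ball y \<rho>"] A0B S' cD(1) by (simp add: ennreal_mult)
        obtain b where b: "mu (ball y \<rho>) = ennreal b" "0 < b"
          using fin[OF \<rho>(1), of y] by (cases "mu (ball y \<rho>)") (auto)
        have "mu (cball x \<delta>) \<le> mu (ball y (2 ^ 3 * (\<delta> / 4)))"
        proof (intro mu_mono[OF reg] subsetI)
          fix z assume "z \<in> cball x \<delta>"
          moreover have "dist y z \<le> dist x y + dist x z" by metric
          ultimately show "z \<in> ball y (2 ^ 3 * (\<delta> / 4))" using dxy \<delta>(2) by simp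
        qed
        also have "\<dots> \<le> ennreal (cD ^ 3) * mu (ball y (\<delta> / 4))"
          using cD \<delta>(2) by (intro ball_doubling_power) auto
        also have "\<dots> \<le> ennreal (cD ^ 3) * mu (ball y \<rho>)"
          using False by (intro mult_left_mono mu_mono[OF reg]) auto
        also have "\<dots> = ennreal (cD ^ 3 * b)"
          using b cD(1) by (simp add: ennreal_mult)
        finally have mb: "m \<le> cD ^ 3 * b"
          using m b cD(1) by (simp add: ennreal_le_iff)
        have "average mu (ball y \<rho>) (\<lambda>z. enn_powr (g z) p) \<le> ennreal (cD * S') / ennreal b"
          unfolding average_def b(1) N_def[symmetric] by (intro divide_right_mono_ennreal int)
        also have "\<dots> = ennreal (cD * S' / b)"
          using b(2) S'(2) cD(1) by (intro divide_ennreal) auto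
        also have "cD * S' / b \<le> t"
        proof -
          have "cD * S' * m \<le> cD * S' * (cD ^ 3 * b)"
            using mb S'(2) cD(1) by (intro mult_left_mono) auto
          then show ?thesis
            using b(2) m(2) by (simp add: t_def divide_simps power_numeral_reduce mult_ac)
        qed
        finally show ?thesis by (simp add: ennreal_leI)
      qed
      then have "maximal_function mu (L * boundary_dist \<Omega> y) (\<lambda>z. enn_powr (g z) p) y \<le> ennreal t"
        unfolding maximal_function_def by (intro SUP_least) auto
      then have "enn_powr (maximal_function mu (L * boundary_dist \<Omega> y) (\<lambda>z. enn_powr (g z) p) y) (1 / p)
          \<le> ennreal (t powr (1 / p))"
        using p t0 enn_powr_mono[of "1 / p"] by (fastforce simp: enn_powr_ennreal)
      then have "ennreal (cH * boundary_dist \<Omega> y) *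
          enn_powr (maximal_function mu (L * boundary_dist \<Omega> y) (\<lambda>z. enn_powr (g z) p) y) (1 / p)
          \<le> ennreal (cH * (5 / 4 * \<delta>)) * ennreal (t powr (1 / p))"
        by (intro mult_mono ennreal_leI[OF bd(1)]) auto

      \<comment> \<open>Comparison of the content sum with the measure\<close>
      with le have "1 \<le> ennreal (cH * (5 / 4 * \<delta>)) * ennreal (t powr (1 / p))"
        by (simp add: u1 one_ennreal.abs_eq)
      then have "1 \<le> (5 / 4 * cH) * \<delta> * t powr (1 / p)"
        using cH \<delta>(2) by (simp add: ennreal_mult[symmetric] mult_ac)
      \<comment> \<open>The power \<open>p\<close> undoes the exponent \<open>1 / p\<close> of
        \<open>t\<close>; the factor \<open>\<delta> powr p\<close> it creates later cancels against
        \<open>\<delta> powr (- p)\<close>.\<close>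
      then have "1 powr p \<le> ((5 / 4 * cH) * \<delta> * t powr (1 / p)) powr p"
        using p by (intro powr_mono2) auto
      also have "\<dots> = (5 / 4 * cH) powr p * \<delta> powr p * t"
      proof -
        have "(a * b * d) powr p = a powr p * b powr p * d powr p"
          if "0 \<le> a" "0 \<le> b" "0 \<le> d" for a b d :: real
          using that by (simp add: powr_mult)
        from this[of "5 / 4 * cH" \<delta> "t powr (1 / p)"] show ?thesis
          using cH \<delta>(2) p t0 by (simp add: powr_powr)
      qed
      finally have "m \<le> (5 / 4 * cH) powr p * \<delta> powr p * (cD ^ 4 * S')"
        using m(2) by (simp add: t_def field_simps)
      then have "C * \<delta> powr (- p) * m
          \<le> C * \<delta> powr (- p) * ((5 / 4 * cH) powr p * \<delta> powr p * (cD ^ 4 * S'))"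
        using C(1) by (intro mult_left_mono) auto
      also have "\<dots> = (C * (cD ^ 4 * (5 / 4 * cH) powr p)) * S'"
        using \<delta>(2) by (simp add: powr_minus field_simps)
      also have "\<dots> \<le> S'"
        using C(1,3) cD(1) S'(2) by (intro mult_left_le_one_le) auto
      finally have "ennreal (C * \<delta> powr (- p) * m) \<le> S"
        by (simp add: S' ennreal_leI)
      then have "ennreal (C * \<delta> powr (- p)) * mu (cball x \<delta>) \<le> S"
        using m C(1) by (simp add: ennreal_mult)
      then show ?thesis using S_le by (rule order_trans)
    qed
  qed
  then show ?thesis by (simp only: s_def[abs_def])
qed

theorem lemma6p1:
  fixes mu :: "'a::complete_space set \<Rightarrow> ennreal"
    and p cH L :: real
    and \<Omega> :: "'a set"
  assumes "1 \<le> p"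
    and "borel_regular_outer_measure mu"
    and "\<And>x r. 0 < r \<Longrightarrow> 0 < mu (ball x r) \<and> mu (ball x r) < \<infinity>"
    and "doubling mu"
    and "poincare_inequality mu p"
    and "open \<Omega>" and "\<Omega> \<noteq> UNIV"
    and "0 < cH" and "1 \<le> L"
    and "pointwise_hardy mu p \<Omega> cH L"
  shows "\<exists>C>0. \<forall>x\<in>\<Omega>.
    hausdorff_content mu p (boundary_dist \<Omega> x)
        (frontier \<Omega> \<inter> cball x (2 * L * boundary_dist \<Omega> x))
      \<ge> ennreal (C * boundary_dist \<Omega> x powr (- p)) * mu (cball x (boundary_dist \<Omega> x))"
proof -
  obtain cD where cD: "1 \<le> cD" "\<And>x r. 0 < r \<Longrightarrow> mu (ball x (2 * r)) \<le> ennreal cD * mu (ball x r)"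
    using \<open>doubling mu\<close> unfolding doubling_def by blast
  obtain k :: nat where "40 * L < 2 ^ k"
    using real_arch_pow[of 2 "40 * L"] by auto
  then have k: "40 * L \<le> 2 ^ k" by simp
  \<comment> \<open>One entry for each case of the single-cover estimate; both depend only on
    \<open>cD\<close>, \<open>L\<close> (through \<open>k\<close>), \<open>p\<close> and
    \<open>cH\<close>, so \<open>C\<close> is uniform in \<open>x\<close>.\<close>
  define C where "C = min (1 / cD ^ k) (1 / (cD ^ 4 * (5 / 4 * cH) powr p))"
  have pos: "0 < cD ^ k" "0 < cD ^ 4 * (5 / 4 * cH) powr p"
    using cD(1) \<open>0 < cH\<close> by auto
  then have C: "0 < C" "C * cD ^ k \<le> 1" "C * (cD ^ 4 * (5 / 4 * cH) powr p) \<le> 1"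
    unfolding C_def by (simp_all add: pos_le_divide_eq[symmetric])
  have "ennreal (C * boundary_dist \<Omega> x powr (- p)) * mu (cball x (boundary_dist \<Omega> x))
      \<le> hausdorff_content mu p (boundary_dist \<Omega> x)
        (frontier \<Omega> \<inter> cball x (2 * L * boundary_dist \<Omega> x))" if x: "x \<in> \<Omega>" for x
  proof (cases "boundary_dist \<Omega> x = 0")
    case False
    then have \<delta>: "0 < boundary_dist \<Omega> x"
      using infdist_nonneg[of x "frontier \<Omega>"] by (simp add: boundary_dist_def)
    show ?thesis
      unfolding hausdorff_content_def
      using frontier_content_sum_ge[OF assms(1-3) cD \<open>open \<Omega>\<close> \<open>1 \<le> L\<close> k \<open>0 < cH\<close>
          \<open>pointwise_hardy mu p \<Omega> cH L\<close> x refl \<delta> _ _ C]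
      by (intro INF_greatest) (clarsimp split: prod.splits)
  \<comment> \<open>Distance zero at a point of the open set \<open>\<Omega>\<close> can only come
    from an empty frontier, through \<open>infdist x {} = 0\<close>. Then
    \<open>0 powr (- p) = 0\<close> makes the lower bound zero.\<close>
  qed simp
  with C(1) show ?thesis by blast
qed

end
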